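(* Consider the Generalized Multiple Strip Packing Problem with the makespan objective $\max_{i\in\mathcal I}H_i$. For every instance, the optimal value of the linear program LP-PC (with makespan objective) is at least the optimal value of the LP relaxation of the liquified scheduling problem, i.e. LP-PC dominates $$\min\Bigl\{H:\ \sum_{j\in\mathcal J}s_{ij}v_{ij}\le H\ \ \forall i\in\mathcal I,\ \ \sum_{i\in\mathcal I}v_{ij}=1\ \ \forall j\in\mathcal J,\ \ 0\le v_{ij}\le 1,\ \ v_{ij}=0\text{ if }w_{ij}>W_i\Bigr\},\qquad s_{ij}=\frac{w_{ij}h_{ij}}{W_i}.$$
   Context: **Instance.** Items $\mathcal J=\{1,\dots,n\}$, strips $\mathcal I=\{1,\dots,m\}$; strip $i$ has positive integer width $W_i$ and infinite height. Item $j$, if assigned to strip $i$, is a rectangle of positive integer width $w_{ij}$ and positive integer height $h_{ij}$. Item $j$ may be packed in strip $i$ only if $w_{ij}\le W_i$ (then the pair $(i,j)$ is called eligible); every item is eligible for at least one strip. In the problem, each item is packed exactly once in some strip, without overlap and without rotation; $H_i\ge0$ denotes the height of strip $i$, and the makespan is $\max_iH_i$. **Normal positions.** For an eligible pair $(i,j)$, $\mathcal W_i(j)$ is the set of $p\in\{0,\dots,W_i-w_{ij}\}$ that can be written as $\sum_{k\in S}w_{ik}$ for some subset $S\subseteq\mathcal J\setminus\{j\}$ (the empty sum $0$ is allowed); for non-eligible pairs $\mathcal W_i(j)=\emptyset$. For $q\in\{0,\dots,W_i-1\}$, $\mathcal W_i(j,q)=\{p\in\mathcal W_i(j): p\le q\le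 p+w_{ij}-1\}$ is the subset of positions at which item $j$ covers column $q$. **LP-PC (makespan).** LP-PC is the linear program with variables $0\le x_{ijp}\le 1$ ($i\in\mathcal I$, $j\in\mathcal J$, $p\in\mathcal W_i(j)$), $H_i\ge 0$ and $H^{\max}$, minimizing $H^{\max}$ subject to - $H^{\max}\ge H_i$ for all $i\in\mathcal I$; - $\sum_{i}\sum_{p\in\mathcal W_i(j)}x_{ijp}=1$ for all $j\in\mathcal J$; - $\sum_{j}\sum_{p\in\mathcal W_i(j,q)}h_{ij}x_{ijp}\le H_i$ for all $i\in\mathcal I$, $q\in\{0,\dots,W_i-1\}$; - $h_{ij}\sum_{p\in\mathcal W_i(j)}x_{ijp}\le H_i$ for all $i\in\mathcal I$, $j\in\mathcal J$. **Liquified scheduling problem.** This is the integer program obtained from the minimization displayed in the claim by requiring $v_{ij}\in\{0,1\}$; its LP relaxation is the displayed problem. *)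

theory Defs
  imports Complex_Main "HOL-Library.Extended_Real"
begin

text \<open>
  Throughout, items are \<open>{1..n}\<close> and strips are \<open>{1..m}\<close>; strip \<open>i\<close> has width \<open>W i\<close>, and item \<open>j\<close>
  packed in strip \<open>i\<close> has width \<open>w i j\<close> and height \<open>h i j\<close>. Values at other indices are irrelevant.
\<close>

definition gmspp_instance ::
  "nat \<Rightarrow> nat \<Rightarrow> (nat \<Rightarrow> nat) \<Rightarrow> (nat \<Rightarrow> nat \<Rightarrow> nat) \<Rightarrow> (nat \<Rightarrow> nat \<Rightarrow> nat) \<Rightarrow> bool" where
  "gmspp_instance n m W w h \<longleftrightarrow>
     (\<forall>i\<in>{1..m}. 0 < W i) \<and>
     (\<forall>i\<in>{1..m}. \<forall>j\<in>{1..n}. 0 < w i j \<and> 0 < h i j) \<and>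
     (\<forall>j\<in>{1..n}. \<exists>i\<in>{1..m}. w i j \<le> W i)"

text \<open>The case distinction is needed because subtraction on \<^typ>\<open>nat\<close> truncates.\<close>

definition normal_positions ::
  "nat \<Rightarrow> (nat \<Rightarrow> nat) \<Rightarrow> (nat \<Rightarrow> nat \<Rightarrow> nat) \<Rightarrow> nat \<Rightarrow> nat \<Rightarrow> nat set" where
  "normal_positions n W w i j =
     (if w i j \<le> W i
      then {p \<in> {0..W i - w i j}. \<exists>S \<subseteq> {1..n} - {j}. p = (\<Sum>k\<in>S. w i k)}
      else {})"

definition covering_positions ::
  "nat \<Rightarrow> (nat \<Rightarrow> nat) \<Rightarrow> (nat \<Rightarrow> nat \<Rightarrow> nat) \<Rightarrow> nat \<Rightarrow> nat \<Rightarrow> nat \<Rightarrow> nat set" where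
  "covering_positions n W w i j q =
     {p \<in> normal_positions n W w i j. p \<le> q \<and> q \<le> p + w i j - 1}"

definition lp_pc_feasible ::
  "nat \<Rightarrow> nat \<Rightarrow> (nat \<Rightarrow> nat) \<Rightarrow> (nat \<Rightarrow> nat \<Rightarrow> nat) \<Rightarrow> (nat \<Rightarrow> nat \<Rightarrow> nat) \<Rightarrow>
   (nat \<Rightarrow> nat \<Rightarrow> nat \<Rightarrow> real) \<Rightarrow> (nat \<Rightarrow> real) \<Rightarrow> real \<Rightarrow> bool" where
  "lp_pc_feasible n m W w h x H Hmax \<longleftrightarrow>
     (\<forall>i\<in>{1..m}. \<forall>j\<in>{1..n}. \<forall>p\<in>normal_positions n W w i j. 0 \<le> x i j p \<and> x i j p \<le> 1) \<and>
     (\<forall>i\<in>{1..m}. 0 \<le> H i) \<and>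
     (\<forall>i\<in>{1..m}. Hmax \<ge> H i) \<and>
     (\<forall>j\<in>{1..n}. (\<Sum>i\<in>{1..m}. \<Sum>p\<in>normal_positions n W w i j. x i j p) = 1) \<and>
     (\<forall>i\<in>{1..m}. \<forall>q\<in>{0..<W i}.
        (\<Sum>j\<in>{1..n}. \<Sum>p\<in>covering_positions n W w i j q. real (h i j) * x i j p) \<le> H i) \<and>
     (\<forall>i\<in>{1..m}. \<forall>j\<in>{1..n}.
        real (h i j) * (\<Sum>p\<in>normal_positions n W w i j. x i j p) \<le> H i)"

text \<open>
  Optimal values are infima in the extended reals, hence meaningful without a prior proof that
  the minimum is attained.
\<close>

definition lp_pc_value ::
  "nat \<Rightarrow> nat \<Rightarrow> (nat \<Rightarrow> nat) \<Rightarrow> (nat \<Rightarrow> nat \<Rightarrow> nat) \<Rightarrow> (nat \<Rightarrow> nat \<Rightarrow> nat) \<Rightarrow> ereal" where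
  "lp_pc_value n m W w h = Inf {ereal Hmax | x H Hmax. lp_pc_feasible n m W w h x H Hmax}"

definition liquified_time ::
  "(nat \<Rightarrow> nat) \<Rightarrow> (nat \<Rightarrow> nat \<Rightarrow> nat) \<Rightarrow> (nat \<Rightarrow> nat \<Rightarrow> nat) \<Rightarrow> nat \<Rightarrow> nat \<Rightarrow> real" where
  "liquified_time W w h i j = real (w i j) * real (h i j) / real (W i)"

definition liquified_lp_feasible ::
  "nat \<Rightarrow> nat \<Rightarrow> (nat \<Rightarrow> nat) \<Rightarrow> (nat \<Rightarrow> nat \<Rightarrow> nat) \<Rightarrow> (nat \<Rightarrow> nat \<Rightarrow> nat) \<Rightarrow>
   (nat \<Rightarrow> nat \<Rightarrow> real) \<Rightarrow> real \<Rightarrow> bool" where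
  "liquified_lp_feasible n m W w h v H \<longleftrightarrow>
     (\<forall>i\<in>{1..m}. (\<Sum>j\<in>{1..n}. liquified_time W w h i j * v i j) \<le> H) \<and>
     (\<forall>j\<in>{1..n}. (\<Sum>i\<in>{1..m}. v i j) = 1) \<and>
     (\<forall>i\<in>{1..m}. \<forall>j\<in>{1..n}. 0 \<le> v i j \<and> v i j \<le> 1) \<and>
     (\<forall>i\<in>{1..m}. \<forall>j\<in>{1..n}. w i j > W i \<longrightarrow> v i j = 0)"

definition liquified_lp_value ::
  "nat \<Rightarrow> nat \<Rightarrow> (nat \<Rightarrow> nat) \<Rightarrow> (nat \<Rightarrow> nat \<Rightarrow> nat) \<Rightarrow> (nat \<Rightarrow> nat \<Rightarrow> nat) \<Rightarrow> ereal" where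
  "liquified_lp_value n m W w h = Inf {ereal H | v H. liquified_lp_feasible n m W w h v H}"

end

theory Submission
  imports Defs
begin

text \<open>
  Given a feasible point of LP-PC, put \<open>v\<^sub>i\<^sub>j = \<Sum>\<^sub>p x\<^sub>i\<^sub>j\<^sub>p\<close>. An item placed at a normal position of strip
  \<open>i\<close> covers exactly \<open>w\<^sub>i\<^sub>j\<close> of the \<open>W\<^sub>i\<close> columns, so summing the column constraints of strip \<open>i\<close>
  over all columns gives \<open>\<Sum>\<^sub>j w\<^sub>i\<^sub>j h\<^sub>i\<^sub>j v\<^sub>i\<^sub>j \<le> W\<^sub>i H\<^sub>i\<close>. Hence \<open>v\<close> is feasible for the liquified
  relaxation with the same objective value.
\<close>

lemma finite_normal_positions: "finite (normal_positions n W w i j)"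
  unfolding normal_positions_def by simp

lemma sum_covering_positions:
  fixes x :: "nat \<Rightarrow> real"
  assumes "0 < w i j"
  shows "(\<Sum>q\<in>{0..<W i}. \<Sum>p\<in>covering_positions n W w i j q. x p) =
    real (w i j) * (\<Sum>p\<in>normal_positions n W w i j. x p)"
proof -
  let ?N = "normal_positions n W w i j"
  \<comment> \<open>The bound \<open>p \<le> W i - w i j\<close> keeps the block within the strip;
    \<open>0 < w i j\<close> matters at \<open>p = 0\<close>, where \<open>p + w i j - 1\<close>
    would otherwise truncate.\<close>
  have columns: "{q \<in> {0..<W i}. p \<le> q \<and> q \<le> p + w i j - 1} = {p..<p + w i j}"
    if "p \<in> ?N" for p
    using that assms by (auto simp: normal_positions_def split: if_splits)
  have "(\<Sum>q\<in>{0..<W i}. \<Sum>p\<in>covering_positions n W w i j q. x p) =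
      (\<Sum>p\<in>?N. \<Sum>q | q \<in> {0..<W i} \<and> p \<le> q \<and> q \<le> p + w i j - 1. x p)"
    unfolding covering_positions_def
    by (rule sum.swap_restrict) (simp_all add: finite_normal_positions)
  also have "\<dots> = (\<Sum>p\<in>?N. real (w i j) * x p)"
    by (rule sum.cong) (simp_all only: columns sum_constant card_atLeastLessThan add_diff_cancel_left')
  finally show ?thesis
    by (simp add: sum_distrib_left)
qed

lemma liquified_lp_feasible_of_lp_pc_feasible:
  assumes inst: "gmspp_instance n m W w h"
    and feas: "lp_pc_feasible n m W w h x H Hmax"
  shows "liquified_lp_feasible n m W w h
    (\<lambda>i j. \<Sum>p\<in>normal_positions n W w i j. x i j p) Hmax"
proof -
  define v where "v i j = (\<Sum>p\<in>normal_positions n W w i j. x i j p)" for i j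
  have v_nonneg: "0 \<le> v i j" if "i \<in> {1..m}" "j \<in> {1..n}" for i j
    using feas that unfolding v_def lp_pc_feasible_def by (intro sum_nonneg) blast
  have v_sum: "(\<Sum>i\<in>{1..m}. v i j) = 1" if "j \<in> {1..n}" for j
    using feas that unfolding v_def lp_pc_feasible_def by blast
  \<comment> \<open>A single term of a nonnegative sum equal to 1 is at most 1; the bounds
    \<open>x i j p \<le> 1\<close> would only limit \<open>v i j\<close> by the number of
    positions.\<close>
  have v_le_1: "v i j \<le> 1" if "i \<in> {1..m}" "j \<in> {1..n}" for i j
    using member_le_sum[of i "{1..m}" "\<lambda>i. v i j"] v_sum v_nonneg that by simp
  have load: "(\<Sum>j\<in>{1..n}. liquified_time W w h i j * v i j) \<le> Hmax" if i: "i \<in> {1..m}" for i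
  proof -
    have W_pos: "0 < W i" and w_pos: "\<And>j. j \<in> {1..n} \<Longrightarrow> 0 < w i j"
      using inst i unfolding gmspp_instance_def by auto
    \<comment> \<open>Pulling \<open>h i j\<close> out of the sums over \<open>p\<close> and
      \<open>q\<close> leaves the column count of \<open>sum_covering_positions\<close>.\<close>
    have "(\<Sum>j\<in>{1..n}. real (w i j) * real (h i j) * v i j) =
        (\<Sum>j\<in>{1..n}. \<Sum>q\<in>{0..<W i}. \<Sum>p\<in>covering_positions n W w i j q. real (h i j) * x i j p)"
      by (intro sum.cong)
        (simp_all add: w_pos v_def sum_covering_positions flip: sum_distrib_left)
    also have "\<dots> = (\<Sum>q\<in>{0..<W i}. \<Sum>j\<in>{1..n}.
        \<Sum>p\<in>covering_positions n W w i j q. real (h i j) * x i j p)"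
      by (rule sum.swap)
    also have "\<dots> \<le> (\<Sum>q\<in>{0..<W i}. H i)"
      using feas i unfolding lp_pc_feasible_def by (intro sum_mono) blast
    also have "\<dots> \<le> real (W i) * Hmax"
      using feas i unfolding lp_pc_feasible_def by (simp add: mult_left_mono)
    finally show ?thesis
      using W_pos
      by (simp add: liquified_time_def pos_divide_le_eq mult.commute flip: sum_divide_distrib)
  qed
  have ineligible: "v i j = 0" if "W i < w i j" for i j
    using that unfolding v_def normal_positions_def by simp
  have "liquified_lp_feasible n m W w h v Hmax"
    unfolding liquified_lp_feasible_def using load v_sum v_nonneg v_le_1 ineligible by blast
  then show ?thesis
    unfolding v_def .
qed

theorem proposition3:
  fixes n m :: nat
    and W :: "nat \<Rightarrow> nat"
    and w h :: "nat \<Rightarrow> nat \<Rightarrow> nat"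
  assumes "gmspp_instance n m W w h"
  shows "lp_pc_value n m W w h \<ge> liquified_lp_value n m W w h"
  unfolding lp_pc_value_def liquified_lp_value_def
  \<comment> \<open>Each LP-PC objective value is also attained in the relaxation, so the latter
    infimum ranges over a larger set.\<close>
  by (rule Inf_superset_mono) (use liquified_lp_feasible_of_lp_pc_feasible[OF assms] in blast)

end
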